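(* Let $F$ be a field and $A\in M_q(F)$ a square matrix whose characteristic polynomial splits over $F$. Let $\pmb{N}(A)$ be the non-geometric part of $A$ and let $\pmb{\mathcal{A}}_0$ and $\pmb{\mathcal{A}}_1$ be the $0$th and the $1$st coordinates of $A$ with respect to $(\mathcal{S}^{\ast},\mathcal{T})$. Then the diagonalizable part of $A$ is $A_s=\pmb{\mathcal{A}}_0(1)$ and the nilpotent part of $A$ is $A_n=A-A_s=\pmb{N}(A)(1)+\pmb{\mathcal{A}}_1(1)$.
   Context: $\mathcal{C}_F$ is the $F$-algebra of all sequences over $F$ indexed by $k\ge0$, with componentwise operations; sequences of $q\times q$ matrices over $F$ are identified with elements of $M_q(\mathcal{C}_F)$, and $\pmb{U}(k)$ denotes the $k$th term of such a sequence $\pmb{U}$. For $\lambda\in F\setminus\{0\}$, $\pmb{\lambda}=(\lambda^k)_{k\ge0}$; $\mathcal{S}^{\ast}=\{\pmb{\lambda}:\lambda\in F,\lambda\ne0\}$; for $i\in\mathbb{N}$, $\pmb{0}_i$ is the sequence with $\pmb{0}_i(k)=\delta_{ik}$; $\mathcal{S}^{\circ}=\{\pmb{0}_i:i\ge0\}$. $F_{\mathcal{S}^{\ast}}$ and $F_{\mathcal{S}^{\circ}}$ are the $F$-spans of $\mathcal{S}^{\ast}$ and $\mathcal{S}^{\circ}$. For $i\ge0$, $\pmb{\Lambda}_i=(\binom{k}{i})_{k\ge0}$ (integers viewed in $F$), and $\mathcal{T}=\{\pmb{\Lambda}_i:i\ge0\}$. If the characteristic polynomial of $A$ splits over $F$,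 then $(A^k)_{k\ge0}$ can be written in exactly one way (up to zero terms) as $\pmb{N}(A)+\pmb{\mathcal{A}}_0\pmb{\Lambda}_0+\cdots+\pmb{\mathcal{A}}_l\pmb{\Lambda}_l$ with $\pmb{N}(A)\in M_q(F_{\mathcal{S}^{\circ}})$ and $\pmb{\mathcal{A}}_i\in M_q(F_{\mathcal{S}^{\ast}})$ (the $\mathcal{P}$-canonical form of $A$ relative to $(\mathcal{S}^{\ast},\mathcal{T})$). $\pmb{N}(A)$ is the non-geometric part of $A$, and $\pmb{\mathcal{A}}_i$ is the $i$th coordinate of $A$ with respect to $(\mathcal{S}^{\ast},\mathcal{T})$ ($\pmb{\mathcal{A}}_i=0$ for $i>l$). The diagonalizable and nilpotent parts of $A$ are those of its Jordan–Chevalley decomposition: $A=A_s+A_n$ with $A_s$ diagonalizable, $A_n$ nilpotent, $A_sA_n=A_nA_s$. *)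

theory Defs
  imports
    "Jordan_Normal_Form.Char_Poly"
    "HOL-Library.Function_Algebras"
begin

text \<open>
  Sequences over a field are functions \<open>nat \<Rightarrow> 'a\<close>; the pointwise operations come from
  \<open>Function_Algebras\<close>, and \<open>seq.span\<close> is the linear span inside this vector space.
\<close>

global_interpretation seq: vector_space "\<lambda>(c::'a::field) (s::nat \<Rightarrow> 'a) k. c * s k"
  by unfold_locales (auto simp: fun_eq_iff algebra_simps)

definition geom_seqs :: "(nat \<Rightarrow> 'a::field) set" where
  "geom_seqs = {(\<lambda>k. x ^ k) | x. x \<noteq> 0}"

definition delta_seqs :: "(nat \<Rightarrow> 'a::field) set" where
  "delta_seqs = {(\<lambda>k. if k = i then 1 else 0) | i. True}"

definition binom_seq :: "nat \<Rightarrow> nat \<Rightarrow> 'a::field" where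
  "binom_seq i = (\<lambda>k. of_nat (k choose i))"

text \<open>
  For a set \<open>V\<close> of scalar sequences, the \<open>q \<times> q\<close> matrices with entries in \<open>V\<close>, regarded as
  sequences of matrices over the field.
\<close>

definition seq_mats :: "nat \<Rightarrow> (nat \<Rightarrow> 'a::field) set \<Rightarrow> (nat \<Rightarrow> 'a mat) set" where
  "seq_mats q V = {U. (\<forall>k. U k \<in> carrier_mat q q) \<and>
     (\<forall>r<q. \<forall>c<q. (\<lambda>k. U k $$ (r, c)) \<in> V)}"

text \<open>
  The coordinates are an infinite family \<open>C\<close> that vanishes beyond some index \<open>l\<close>, so that the
  form is unique on the nose and not merely up to zero terms. The inner matrix is
  \<open>C 0 k * binom_seq 0 k + \<dots> + C l k * binom_seq l k\<close>, written entrywise because matrices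
  of unspecified dimension have no \<open>sum\<close>.
\<close>

definition canonical_form ::
  "'a::field mat \<Rightarrow> (nat \<Rightarrow> 'a mat) \<Rightarrow> (nat \<Rightarrow> nat \<Rightarrow> 'a mat) \<Rightarrow> bool" where
  "canonical_form A N C \<longleftrightarrow> (let q = dim_row A in
     N \<in> seq_mats q (seq.span delta_seqs) \<and>
     (\<forall>i. C i \<in> seq_mats q (seq.span geom_seqs)) \<and>
     (\<exists>l. (\<forall>i>l. \<forall>k. C i k = 0\<^sub>m q q) \<and>
          (\<forall>k. A ^\<^sub>m k =
             N k + mat q q (\<lambda>(r, c). \<Sum>i\<le>l. C i k $$ (r, c) * binom_seq i k))))"

definition nongeom_part :: "'a::field mat \<Rightarrow> nat \<Rightarrow> 'a mat" where
  "nongeom_part A = (THE N. \<exists>C. canonical_form A N C)"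

definition coord :: "'a::field mat \<Rightarrow> nat \<Rightarrow> nat \<Rightarrow> 'a mat" where
  "coord A = (THE C. \<exists>N. canonical_form A N C)"

definition diagonalizable_mat :: "'a::field mat \<Rightarrow> bool" where
  "diagonalizable_mat A \<longleftrightarrow> (\<exists>D. diagonal_mat D \<and> similar_mat A D)"

definition nilpotent_mat :: "'a::field mat \<Rightarrow> bool" where
  "nilpotent_mat A \<longleftrightarrow> (\<exists>m. A ^\<^sub>m m = 0\<^sub>m (dim_row A) (dim_row A))"

definition jordan_chevalley :: "'a::field mat \<Rightarrow> 'a mat \<Rightarrow> 'a mat \<Rightarrow> bool" where
  "jordan_chevalley A S N \<longleftrightarrow>
     S \<in> carrier_mat (dim_row A) (dim_row A) \<and> N \<in> carrier_mat (dim_row A) (dim_row A) \<and>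
     A = S + N \<and> diagonalizable_mat S \<and> nilpotent_mat N \<and> S * N = N * S"

definition diag_part :: "'a::field mat \<Rightarrow> 'a mat" where
  "diag_part A = (THE S. \<exists>N. jordan_chevalley A S N)"

definition nilp_part :: "'a::field mat \<Rightarrow> 'a mat" where
  "nilp_part A = (THE N. \<exists>S. jordan_chevalley A S N)"

end

theory Submission
  imports
    Defs
    "Jordan_Normal_Form.Jordan_Normal_Form_Existence"
    "Jordan_Normal_Form.DL_Rank"
begin

text \<open>
  Let \<open>A = S + N\<close> be any Jordan--Chevalley decomposition. As \<open>S\<close> and \<open>N\<close> commute,
  \<open>A\<^sup>k\<close> is the sum of \<open>(k choose i) S\<^bsup>k-i\<^esup> N\<^sup>i\<close> over \<open>i \<le> k\<close>. Write
  \<open>S = P diag(d) Q\<close> with \<open>Q = P\<^sup>-\<^sup>1\<close>. An eigenvalue \<open>d\<^sub>j \<noteq> 0\<close> contributes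
  \<open>d\<^sub>j\<^bsup>k-i\<^esup> = d\<^sub>j\<^bsup>-i\<^esup> d\<^sub>j\<^sup>k\<close>, a multiple of a geometric sequence, and an eigenvalue \<open>0\<close>
  contributes only when \<open>i = k\<close>. With \<open>E\<close> the spectral projection of \<open>S\<close> for the eigenvalue \<open>0\<close>
  this is a canonical form of \<open>A\<close>: its non-geometric part is \<open>E N\<^sup>k\<close>, its \<open>0\<close>th coordinate at
  \<open>1\<close> is \<open>S\<close>, and its \<open>1\<close>st coordinate at \<open>1\<close> is \<open>(1 - E) N\<close>. The last, added to the
  non-geometric part \<open>E N\<close> at \<open>1\<close>, gives \<open>N\<close> (\<open>canonical_form_if_jordan_chevalley\<close>).

  Canonical forms are unique (\<open>canonical_form_unique\<close>), because the sequences
  \<open>(k choose i) x\<^sup>k\<close> with \<open>x \<noteq> 0\<close> are linearly independent even modulo finitely supported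
  sequences, in every characteristic (\<open>binomial_exponential_independent\<close>). Hence \<open>S\<close> and \<open>N\<close> are
  determined by the canonical form of \<open>A\<close>, and uniqueness of the Jordan--Chevalley decomposition
  comes for free. A decomposition exists when the characteristic polynomial splits
  (\<open>jordan_chevalley_exists\<close>): \<open>A\<close> is then similar to an upper triangular matrix, hence to a Jordan
  matrix, which is the sum of its diagonal and its superdiagonal.
\<close>

section \<open>Existence of the Jordan--Chevalley decomposition\<close>

lemma invertible_with_first_column:
  fixes v :: "'a::field vec"
  assumes v: "v \<in> carrier_vec n" and v0: "v \<noteq> 0\<^sub>v n" and n: "0 < n"
  shows "\<exists>W W'. W \<in> carrier_mat n n \<and> W' \<in> carrier_mat n n \<and>
    W * W' = 1\<^sub>m n \<and> W' * W = 1\<^sub>m n \<and> col W 0 = v"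
proof -
  interpret vec_space "TYPE('a)" n .
  let ?b = "basis_completion v"
  note b = basis_completion[OF v v0]
  define W where "W = mat_of_cols n ?b"
  have W: "W \<in> carrier_mat n n"
    unfolding W_def using b(6) by (metis mat_of_cols_carrier(1))
  have cols: "cols W = ?b"
    unfolding W_def by (rule cols_mat_of_cols[OF b(2)])
  have "rank W = n"
    by (rule lin_indpt_full_rank[OF W]) (use b cols in auto)
  hence "det W \<noteq> 0"
    using det_rank_iff[OF W] by simp
  then obtain W' where W': "W' \<in> carrier_mat n n" "W' * W = 1\<^sub>m n"
    using det_non_zero_imp_unit[OF W, of "()"] unfolding Units_def ring_mat_def by auto
  have "col W 0 = v"
    using b(6,7) n v by (cases ?b) (auto simp: W_def)
  thus ?thesis
    using W W' mat_mult_left_right_inverse[OF W'(1) W W'(2)] by blast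
qed

text \<open>
  Induction on the number of eigenvalues: conjugating by an invertible matrix whose first column is
  an eigenvector splits off a \<open>1 \<times> 1\<close> block. No inner product is involved, so this works over
  every field.
\<close>

lemma triangularizable_if_char_poly_splits:
  fixes A :: "'a::field mat"
  assumes "A \<in> carrier_mat n n" and "char_poly A = (\<Prod>a\<leftarrow>as. [:- a, 1:])"
  shows "\<exists>B. B \<in> carrier_mat n n \<and> upper_triangular B \<and> similar_mat A B"
  using assms
proof (induction as arbitrary: n A)
  case Nil
  hence "n = 0"
    using degree_monic_char_poly[of A n] by auto
  thus ?case
    using Nil(1) similar_mat_refl[OF Nil(1)] by (intro exI[of _ A]) auto
next
  case (Cons e es)
  note A = Cons.prems(1)
  have e: "eigenvalue A e"
    unfolding eigenvalue_root_char_poly[OF A] Cons.prems(2) by simp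
  then obtain v where v: "v \<in> carrier_vec n" "v \<noteq> 0\<^sub>v n" and Av: "A *\<^sub>v v = e \<cdot>\<^sub>v v"
    using A unfolding eigenvalue_def eigenvector_def by auto
  then obtain m where n: "n = 1 + m"
    by (cases n) auto
  obtain W W' where W: "W \<in> carrier_mat n n" and W': "W' \<in> carrier_mat n n"
    and WW': "W * W' = 1\<^sub>m n" "W' * W = 1\<^sub>m n" and col: "col W 0 = v"
    using invertible_with_first_column[OF v] n by auto
  define A' where "A' = W' * A * W"
  have A': "A' \<in> carrier_mat n n"
    unfolding A'_def using A W W' by auto
  have sim': "similar_mat A' A"
    by (rule similar_matI[of _ _ W' W n]) (use A A' W W' WW' A'_def in auto)
  have "col A' 0 = (W' * A) *\<^sub>v col W 0"
    unfolding A'_def by (rule col_mult2) (use A W W' n in auto)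
  also have "\<dots> = W' *\<^sub>v (A *\<^sub>v col W 0)"
    by (rule assoc_mult_mat_vec[OF W' A]) (use v(1) col in simp)
  also have "\<dots> = e \<cdot>\<^sub>v (W' *\<^sub>v col W 0)"
    unfolding col Av by (rule mult_mat_vec[OF W' v(1)])
  also have "W' *\<^sub>v col W 0 = col (W' * W) 0"
    using W W' n by (subst col_mult2) auto
  also have "\<dots> = unit_vec n 0"
    unfolding WW' using n by simp
  finally have col0: "A' $$ (i, 0) = (if i = 0 then e else 0)" if "i < n" for i
    using that A' n by (auto simp: col_def vec_eq_iff unit_vec_def)
  obtain A1 A2 A0 A3 where split: "split_block A' 1 1 = (A1, A2, A0, A3)"
    by (cases "split_block A' 1 1") auto
  note blk = split_block[OF split, of m m]
  have A1: "A1 \<in> carrier_mat 1 1" and A2: "A2 \<in> carrier_mat 1 m"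
    and A0: "A0 \<in> carrier_mat m 1" and A3: "A3 \<in> carrier_mat m m"
    and A'b: "A' = four_block_mat A1 A2 A0 A3"
    using blk A' n by auto
  have A1e: "A1 = mat 1 1 (\<lambda>_. e)"
    using split col0[of 0] A' n unfolding split_block_def Let_def by auto
  have A0z: "A0 = 0\<^sub>m m 1"
    using split col0 A' n unfolding split_block_def Let_def by auto
  have "char_poly A1 * char_poly A3 = [:- e, 1:] * (\<Prod>a\<leftarrow>es. [:- a, 1:])"
    using char_poly_four_block_zeros_col[OF A1 A2 A3] char_poly_similar[OF sim']
      Cons.prems(2) unfolding A'b A0z by simp
  moreover have "char_poly A1 = [:- e, 1:]"
    by (simp add: A1e char_poly_defs det_def sign_def)
  ultimately have "char_poly A3 = (\<Prod>a\<leftarrow>es. [:- a, 1:])"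
    by (metis mult_cancel_left pCons_eq_0_iff zero_neq_one)
  from Cons.IH[OF A3 this] obtain B where
    B: "B \<in> carrier_mat m m" "upper_triangular B" "similar_mat A3 B" by auto
  obtain B0 where B0: "B0 \<in> carrier_mat 1 m"
    and sim: "similar_mat A' (four_block_mat A1 B0 (0\<^sub>m m 1) B)"
    using similar_mat_four_block_0_ex[OF similar_mat_refl[OF A1] B(3) A2 A1 A3]
    unfolding A'b A0z by auto
  have "upper_triangular (four_block_mat A1 B0 (0\<^sub>m m 1) B)"
    by (rule upper_triangular_four_block[OF A1 B(1) _ B(2)]) (auto simp: A1e)
  moreover have "four_block_mat A1 B0 (0\<^sub>m m 1) B \<in> carrier_mat n n"
    unfolding n by (rule four_block_carrier_mat[OF A1 B(1)])
  ultimately show ?case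
    using similar_mat_trans[OF similar_mat_sym[OF sim'] sim] by blast
qed


lemma strictly_upper_triangular_nilpotent:
  fixes M :: "'a::field mat"
  assumes M: "M \<in> carrier_mat n n" and z: "\<And>i j. i < n \<Longrightarrow> j \<le> i \<Longrightarrow> M $$ (i, j) = 0"
  shows "nilpotent_mat M"
proof -
  have *: "(M ^\<^sub>m k) $$ (i, j) = 0" if "i < n" "j < n" "j < i + k" for i j k
    using that
  proof (induction k arbitrary: j)
    case 0
    thus ?case using M by simp
  next
    case (Suc k)
    have "(M ^\<^sub>m Suc k) $$ (i, j) = (\<Sum>s = 0..<n. (M ^\<^sub>m k) $$ (i, s) * M $$ (s, j))"
      using M Suc.prems by (simp add: scalar_prod_def)
    also have "\<dots> = 0"
    proof (rule sum.neutral, rule ballI)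
      fix s assume s: "s \<in> {0..<n}"
      show "(M ^\<^sub>m k) $$ (i, s) * M $$ (s, j) = 0"
        using s Suc.IH[of s] Suc.prems z[of s j] by (cases "s < i + k") auto
    qed
    finally show ?case .
  qed
  have "M ^\<^sub>m n = 0\<^sub>m n n"
    by (rule eq_matI) (use M * in auto)
  thus ?thesis
    using M unfolding nilpotent_mat_def by auto
qed

lemma jordan_matrix_entry_nonzero_imp_same_eigenvalue:
  assumes "i < dim_row (jordan_matrix n_as)" "j < dim_row (jordan_matrix n_as)"
    and "jordan_matrix n_as $$ (i, j) \<noteq> 0"
  shows "jordan_matrix n_as $$ (i, i) = jordan_matrix n_as $$ (j, j)"
  using assms
proof (induction n_as arbitrary: i j)
  case Nil
  thus ?case by (simp add: jordan_matrix_def)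
next
  case (Cons na n_as)
  obtain n a where na: "na = (n, a)" by force
  show ?case
    using Cons.prems Cons.IH[of "i - n" "j - n"] unfolding na jordan_matrix_Cons
    by (auto split: if_splits)
qed

lemma jordan_chevalley_jordan_matrix:
  fixes n_as :: "(nat \<times> 'a::field) list"
  shows "\<exists>S N. jordan_chevalley (jordan_matrix n_as) S N"
proof -
  let ?J = "jordan_matrix n_as" and ?n = "sum_list (map fst n_as)"
  \<comment> \<open>The diagonal commutes with the rest because every nonzero entry of a Jordan matrix
    joins two positions with the same eigenvalue.\<close>
  define S where "S = mat_diag ?n (\<lambda>i. ?J $$ (i, i))"
  have J: "?J \<in> carrier_mat ?n ?n" by simp
  have S: "S \<in> carrier_mat ?n ?n" unfolding S_def by simp
  have N: "?J - S \<in> carrier_mat ?n ?n" by (rule minus_carrier_mat[OF S])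
  have "?J = S + (?J - S)"
    by (rule eq_matI) (use S J in auto)
  moreover have "diagonalizable_mat S"
    unfolding diagonalizable_mat_def using similar_mat_refl[OF S]
    by (intro exI[of _ S]) (auto simp: S_def mat_diag_def diagonal_mat_def)
  moreover have "nilpotent_mat (?J - S)"
  proof (rule strictly_upper_triangular_nilpotent[OF N])
    fix i j assume "i < ?n" "j \<le> i"
    thus "(?J - S) $$ (i, j) = 0"
      using jordan_matrix_upper_triangular[of i n_as j]
      by (cases "i = j") (auto simp: S_def mat_diag_def)
  qed
  moreover have "S * (?J - S) = (?J - S) * S"
    unfolding S_def mat_diag_mult_left[OF N[unfolded S_def]] mat_diag_mult_right[OF N[unfolded S_def]]
  proof (rule cong_mat[OF refl refl])
    fix i j assume "i < ?n" "j < ?n"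
    thus "(case (i, j) of (i, j) \<Rightarrow> ?J $$ (i, i) * (?J - mat_diag ?n (\<lambda>i. ?J $$ (i, i))) $$ (i, j)) =
      (case (i, j) of (i, j) \<Rightarrow> (?J - mat_diag ?n (\<lambda>i. ?J $$ (i, i))) $$ (i, j) * ?J $$ (j, j))"
      using jordan_matrix_entry_nonzero_imp_same_eigenvalue[of i n_as j]
      by (cases "?J $$ (i, j) = 0") (auto simp: mat_diag_def)
  qed
  ultimately show ?thesis
    using S N J unfolding jordan_chevalley_def by auto
qed

lemma jordan_chevalley_similar:
  fixes A :: "'a::field mat"
  assumes "similar_mat A B" and "jordan_chevalley B S N"
  shows "\<exists>S' N'. jordan_chevalley A S' N'"
proof -
  obtain n P Q where c: "A \<in> carrier_mat n n" "B \<in> carrier_mat n n"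
      "P \<in> carrier_mat n n" "Q \<in> carrier_mat n n"
    and PQ: "P * Q = 1\<^sub>m n" and QP: "Q * P = 1\<^sub>m n" and A: "A = P * B * Q"
    using similar_matD[OF assms(1)] by auto
  have SN: "S \<in> carrier_mat n n" "N \<in> carrier_mat n n" "B = S + N" "S * N = N * S"
      "diagonalizable_mat S" "nilpotent_mat N"
    using assms(2) c unfolding jordan_chevalley_def by auto
  have simS: "similar_mat (P * S * Q) S" 
    by (rule similar_matI[of _ _ P Q n]) (use c SN PQ QP in auto)
  have simN: "similar_mat_wit (P * N * Q) N P Q"
    by (rule similar_mat_witI[of _ _ n]) (use c SN PQ QP in auto)
  have mult: "(P * X * Q) * (P * Y * Q) = P * (X * Y) * Q"
    if X: "X \<in> carrier_mat n n" and Y: "Y \<in> carrier_mat n n" for X Y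
  proof -
    have "(P * X * Q) * (P * Y * Q) = P * X * (Q * P) * Y * Q"
      using c X Y by (simp add: assoc_mult_mat[of _ n n _ n _ n])
    also have "\<dots> = P * (X * Y) * Q"
      using c X Y unfolding QP by (simp add: assoc_mult_mat[of _ n n _ n _ n])
    finally show ?thesis .
  qed
  have "A = P * S * Q + P * N * Q"
    unfolding A SN(3) using c SN
    by (simp add: mult_add_distrib_mat[of _ n n] add_mult_distrib_mat[of _ n n])
  moreover have "diagonalizable_mat (P * S * Q)"
    using SN(5) similar_mat_trans[OF simS] unfolding diagonalizable_mat_def by blast
  moreover have "nilpotent_mat (P * N * Q)"
  proof -
    obtain m where "N ^\<^sub>m m = 0\<^sub>m n n"
      using SN(2,6) unfolding nilpotent_mat_def by auto
    hence "(P * N * Q) ^\<^sub>m m = 0\<^sub>m n n"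
      using similar_mat_wit_pow_id[OF simN, of m] c by simp
    thus ?thesis using c unfolding nilpotent_mat_def by auto
  qed
  moreover have "(P * S * Q) * (P * N * Q) = (P * N * Q) * (P * S * Q)"
    using mult SN by metis
  ultimately have "jordan_chevalley A (P * S * Q) (P * N * Q)"
    using c mult_carrier_mat[OF mult_carrier_mat[OF c(3) SN(1)] c(4)]
      mult_carrier_mat[OF mult_carrier_mat[OF c(3) SN(2)] c(4)]
    unfolding jordan_chevalley_def by auto
  thus ?thesis by blast
qed

lemma jordan_chevalley_exists:
  fixes A :: "'a::field mat"
  assumes "A \<in> carrier_mat q q" and "char_poly A = (\<Prod>a\<leftarrow>as. [:- a, 1:])"
  shows "\<exists>S N. jordan_chevalley A S N"
proof -
  obtain B where B: "B \<in> carrier_mat q q" "upper_triangular B" "similar_mat A B"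
    using triangularizable_if_char_poly_splits[OF assms] by blast
  have "similar_mat A (jordan_matrix (triangular_to_jnf_vector B))"
    using triangular_to_jnf_vector[OF B(1,2)] similar_mat_trans[OF B(3)]
    unfolding jordan_nf_def by blast
  thus ?thesis
    using jordan_chevalley_jordan_matrix jordan_chevalley_similar by blast
qed

section \<open>Spans of geometric and of finitely supported sequences\<close>

lemma span_geom_seqs_expansion:
  fixes f :: "nat \<Rightarrow> 'a::field"
  assumes "f \<in> seq.span geom_seqs"
  shows "\<exists>L c. finite L \<and> 0 \<notin> L \<and> (\<forall>x. x \<notin> L \<longrightarrow> c x = 0) \<and> (\<forall>k. f k = (\<Sum>x\<in>L. c x * x ^ k))"
  using assms
proof (induction rule: seq.span_induct_alt)
  case base
  show ?case by (rule exI[of _ "{}"], rule exI[of _ "\<lambda>_. 0"]) auto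
next
  case (step a g f)
  obtain y where y: "y \<noteq> 0" "g = (\<lambda>k. y ^ k)"
    using step(1) unfolding geom_seqs_def by auto
  obtain L c where L: "finite L" "0 \<notin> L" "\<forall>x. x \<notin> L \<longrightarrow> c x = 0"
    "\<forall>k. f k = (\<Sum>x\<in>L. c x * x ^ k)"
    using step(2) by auto
  let ?c = "\<lambda>x. c x + (if x = y then a else 0)"
  have "a * y ^ k + f k = (\<Sum>x\<in>insert y L. ?c x * x ^ k)" for k
  proof -
    have "(\<Sum>x\<in>insert y L. ?c x * x ^ k) =
        (\<Sum>x\<in>insert y L. c x * x ^ k) + (\<Sum>x\<in>insert y L. if x = y then a * y ^ k else 0)"
      by (subst sum.distrib[symmetric], rule sum.cong) (auto simp: algebra_simps)
    also have "(\<Sum>x\<in>insert y L. c x * x ^ k) = (\<Sum>x\<in>L. c x * x ^ k)"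
      by (rule sum.mono_neutral_right) (use L in auto)
    finally show ?thesis using L by simp
  qed
  thus ?case
    using L y by (intro exI[of _ "insert y L"] exI[of _ ?c]) (auto simp: plus_fun_def)
qed

lemma span_geom_seqsI:
  fixes c x :: "'b \<Rightarrow> 'a::field"
  assumes "finite J" and "\<And>j. j \<in> J \<Longrightarrow> x j \<noteq> 0"
  shows "(\<lambda>k. \<Sum>j\<in>J. c j * x j ^ k) \<in> seq.span geom_seqs"
  using assms
proof (induction J rule: finite_induct)
  case empty
  thus ?case using seq.span_zero[of geom_seqs] by (simp add: zero_fun_def)
next
  case (insert i J)
  have "(\<lambda>k. x i ^ k) \<in> geom_seqs"
    using insert.prems unfolding geom_seqs_def by auto
  from seq.span_add[OF seq.span_scale[OF seq.span_base[OF this], of "c i"] insert.IH]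
  show ?case
    using insert by (simp add: plus_fun_def)
qed

lemma span_delta_seqs_iff:
  fixes f :: "nat \<Rightarrow> 'a::field"
  shows "f \<in> seq.span delta_seqs \<longleftrightarrow> (\<exists>K. \<forall>k\<ge>K. f k = 0)"
proof
  assume "f \<in> seq.span delta_seqs"
  thus "\<exists>K. \<forall>k\<ge>K. f k = 0"
  proof (induction rule: seq.span_induct_alt)
    case (step a g f)
    obtain i where g: "g = (\<lambda>k. if k = i then 1 else 0)"
      using step(1) unfolding delta_seqs_def by auto
    obtain K where "\<forall>k\<ge>K. f k = 0"
      using step(2) by auto
    thus ?case
      by (intro exI[of _ "max K (Suc i)"]) (auto simp: g)
  qed auto
next
  assume "\<exists>K. \<forall>k\<ge>K. f k = 0"
  then obtain K where "\<forall>k\<ge>K. f k = 0" ..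
  thus "f \<in> seq.span delta_seqs"
  proof (induction K arbitrary: f)
    case 0
    hence "f = 0" by (auto simp: fun_eq_iff)
    thus ?case by (simp only: seq.span_zero)
  next
    case (Suc K)
    let ?d = "\<lambda>k. if k = K then 1 else (0::'a)"
    have "?d \<in> delta_seqs"
      unfolding delta_seqs_def by auto
    hence d: "(\<lambda>k. f K * ?d k) \<in> seq.span delta_seqs"
      by (rule seq.span_scale[OF seq.span_base])
    have "(\<lambda>k. if k = K then 0 else f k) \<in> seq.span delta_seqs"
      by (rule Suc.IH) (use Suc.prems in \<open>auto simp: le_Suc_eq Suc_le_eq nat_less_le\<close>)
    from seq.span_add[OF d this] show ?case
      by (rule back_subst[of "\<lambda>g. g \<in> _"]) (auto simp: fun_eq_iff)
  qed
qed

lemma sum_binomial_Suc: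
  fixes c :: "nat \<Rightarrow> 'a::comm_semiring_1"
  shows "(\<Sum>i\<le>l. c i * of_nat (Suc k choose i)) =
    (\<Sum>i\<le>l. c i * of_nat (k choose i)) + (\<Sum>i<l. c (Suc i) * of_nat (k choose i))"
  by (induction l) (auto simp: algebra_simps)

section \<open>Linear independence and uniqueness of the canonical form\<close>

text \<open>
  A linear relation between the sequences \<open>(k choose i) x\<^sup>k\<close> with \<open>i < m x\<close> that holds for all
  \<open>k \<ge> K\<close> is trivial. The induction is on the total number of these sequences. For some \<open>y\<close> with
  \<open>m y > 0\<close>, the operator \<open>f \<mapsto> (\<lambda>k. f (k + 1) - y f k)\<close> lowers \<open>m y\<close> by one and keeps the other
  \<open>m x\<close>. No coefficient is divided by an integer, so the characteristic plays no role.
\<close>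

lemma binomial_exponential_independent:
  fixes c :: "'a::field \<Rightarrow> nat \<Rightarrow> 'a"
  assumes "finite L" "0 \<notin> L" 
    and "\<And>x i. x \<in> L \<Longrightarrow> m x \<le> i \<Longrightarrow> c x i = 0" and "\<And>x. x \<in> L \<Longrightarrow> m x \<le> Suc l"
    and "\<And>k. K \<le> k \<Longrightarrow> (\<Sum>x\<in>L. \<Sum>i\<le>l. c x i * of_nat (k choose i) * x ^ k) = 0"
    and "x \<in> L"
  shows "c x i = 0"
  using assms
proof (induction "\<Sum>x\<in>L. m x" arbitrary: c m x i)
  case 0
  thus ?case by simp
next
  case (Suc n)
  have "\<exists>y\<in>L. m y \<noteq> 0"
    using Suc(2) by (metis sum.neutral nat.distinct(1))
  then obtain y where y: "y \<in> L" "m y \<noteq> 0" by auto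
  have y0: "y \<noteq> 0" using y Suc.prems by auto
  \<comment> \<open>The coefficients of the relation after applying the operator.\<close>
  define d where "d x i = (x - y) * c x i + x * c x (Suc i)" for x i
  have cl: "c x (Suc l) = 0" if "x \<in> L" for x
    using Suc.prems(3,4) that by auto
  have shift: "(\<Sum>i\<le>l. d x i * of_nat (k choose i) * x ^ k) =
     (\<Sum>i\<le>l. c x i * of_nat (Suc k choose i) * x ^ Suc k) - y * (\<Sum>i\<le>l. c x i * of_nat (k choose i) * x ^ k)"
    if "x \<in> L" for x k
  proof -
    have "(\<Sum>i<l. c x (Suc i) * of_nat (k choose i)) = (\<Sum>i\<le>l. c x (Suc i) * of_nat (k choose i))"
      using cl[OF that] by (simp flip: lessThan_Suc_atMost)
    hence "(\<Sum>i\<le>l. c x i * of_nat (Suc k choose i)) =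
        (\<Sum>i\<le>l. c x i * of_nat (k choose i)) + (\<Sum>i\<le>l. c x (Suc i) * of_nat (k choose i))"
      by (simp only: sum_binomial_Suc)
    hence "(\<Sum>i\<le>l. c x i * of_nat (Suc k choose i)) * x ^ Suc k =
        x * ((\<Sum>i\<le>l. c x i * of_nat (k choose i)) + (\<Sum>i\<le>l. c x (Suc i) * of_nat (k choose i))) * x ^ k"
      by (simp only: power_Suc mult_ac)
    moreover have "(\<Sum>i\<le>l. d x i * of_nat (k choose i)) =
        (x - y) * (\<Sum>i\<le>l. c x i * of_nat (k choose i)) + x * (\<Sum>i\<le>l. c x (Suc i) * of_nat (k choose i))"
      by (simp add: d_def sum_distrib_left sum.distrib[symmetric] algebra_simps)
    ultimately show ?thesis
      unfolding sum_distrib_right[symmetric] by (simp only:) (simp only: algebra_simps)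
  qed
  have d0: "d x i = 0" if x: "x \<in> L" for x i
  proof (rule Suc.hyps(1)[of "m(y := m y - 1)" d])
    have "(\<Sum>x\<in>L. (m(y := m y - 1)) x) = m y - 1 + (\<Sum>x\<in>L - {y}. m x)"
      using y Suc.prems(1) by (subst sum.remove[of _ y]) (auto intro: sum.cong)
    moreover have "(\<Sum>x\<in>L. m x) = m y + (\<Sum>x\<in>L - {y}. m x)"
      using y Suc.prems(1) by (subst sum.remove[of _ y]) auto
    ultimately show "n = (\<Sum>x\<in>L. (m(y := m y - 1)) x)"
      using Suc.hyps(2) y by simp
  next
    fix z j assume z: "z \<in> L" "(m(y := m y - 1)) z \<le> j"
    show "d z j = 0"
      using z Suc.prems(3)[of z j] Suc.prems(3)[of z "Suc j"] by (cases "z = y") (auto simp: d_def)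
  next
    fix z assume "z \<in> L"
    thus "(m(y := m y - 1)) z \<le> Suc l"
      using Suc.prems(4)[of z] by auto
  next
    fix k assume "K \<le> k"
    thus "(\<Sum>x\<in>L. \<Sum>i\<le>l. d x i * of_nat (k choose i) * x ^ k) = 0"
      using Suc.prems(5)[of k] Suc.prems(5)[of "Suc k"]
      by (simp add: shift sum_subtractf sum_distrib_left[symmetric] del: binomial_Suc_Suc power_Suc
          cong: sum.cong)
  qed (use Suc.prems x in auto)
  \<comment> \<open>For \<open>x \<noteq> y\<close> the operator acts on the coefficients as an invertible bidiagonal matrix;
    for \<open>x = y\<close> it only loses the coefficient of \<open>y\<^sup>k\<close>, which the relation itself then kills.\<close>
  have off: "c x i = 0" if x: "x \<in> L" "x \<noteq> y" for x i
  proof (cases "i \<le> m x")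
    case True
    thus ?thesis
    proof (induction rule: inc_induct)
      case base
      show ?case using Suc.prems(3) x by simp
    next
      case (step j)
      thus ?case using d0[OF x(1), of j] x(2) by (simp add: d_def)
    qed
  qed (use Suc.prems(3) x in auto)
  have on: "c y (Suc i) = 0" for i
    using d0[OF y(1), of i] y0 by (simp add: d_def)
  have "(\<Sum>x\<in>L. \<Sum>i\<le>l. c x i * of_nat (K choose i) * x ^ K) =
      (\<Sum>i\<le>l. c y i * of_nat (K choose i) * y ^ K)"
    using y Suc.prems(1) off by (subst sum.remove[of _ y]) auto
  also have "\<dots> = c y 0 * y ^ K"
    using on by (subst sum.atMost_shift) simp
  finally have "c y 0 = 0"
    using Suc.prems(5)[of K] y0 by simp
  thus ?case
    using on off Suc.prems(6) by (cases "x = y"; cases i) auto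
qed

lemma delta_geom_binomial_independent:
  fixes d :: "nat \<Rightarrow> 'a::field" and g :: "nat \<Rightarrow> nat \<Rightarrow> 'a"
  assumes d: "d \<in> seq.span delta_seqs" and g: "\<And>i. g i \<in> seq.span geom_seqs"
    and z: "\<And>k. d k + (\<Sum>i\<le>l. g i k * binom_seq i k) = 0"
  shows "d k = 0" and "i \<le> l \<Longrightarrow> g i k = 0"
proof -
  have "\<exists>L c. finite L \<and> 0 \<notin> L \<and> (\<forall>x. x \<notin> L \<longrightarrow> c x = 0) \<and> (\<forall>k. g i k = (\<Sum>x\<in>L. c x * x ^ k))" for i
    by (rule span_geom_seqs_expansion[OF g])
  then obtain L c where L: "finite (L i)" "0 \<notin> L i" "x \<notin> L i \<Longrightarrow> c i x = 0"
    "g i k = (\<Sum>x\<in>L i. c i x * x ^ k)" for i x k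
    by metis
  define M where "M = (\<Union>i\<le>l. L i)"
  define b where "b x i = (if i \<le> l then c i x else 0)" for x i
  have M: "finite M" "0 \<notin> M"
    using L by (auto simp: M_def)
  have gM: "g i k = (\<Sum>x\<in>M. b x i * x ^ k)" if "i \<le> l" for i k
    unfolding L(4) using that M L
    by (intro sum.mono_neutral_cong_left) (auto simp: M_def b_def)
  obtain K where K: "\<forall>k\<ge>K. d k = 0"
    using d span_delta_seqs_iff by blast
  have b0: "b x i = 0" if "x \<in> M" for x i
  proof (rule binomial_exponential_independent[OF M, of "\<lambda>_. Suc l" b l K])
    fix k assume "K \<le> k"
    hence "0 = (\<Sum>i\<le>l. g i k * binom_seq i k)"
      using z[of k] K by simp
    also have "\<dots> = (\<Sum>i\<le>l. \<Sum>x\<in>M. b x i * of_nat (k choose i) * x ^ k)"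
      by (rule sum.cong) (simp_all add: gM binom_seq_def sum_distrib_right sum_distrib_left mult_ac)
    finally show "(\<Sum>x\<in>M. \<Sum>i\<le>l. b x i * of_nat (k choose i) * x ^ k) = 0"
      by (subst sum.swap) simp
  qed (use that in \<open>auto simp: b_def\<close>)
  have g0: "g i k = 0" if "i \<le> l" for i k
    using gM[OF that] b0 by simp
  thus "i \<le> l \<Longrightarrow> g i k = 0" .
  show "d k = 0"
    using z[of k] g0 by simp
qed

lemma canonical_form_unique:
  fixes A :: "'a::field mat"
  assumes "canonical_form A N C" and "canonical_form A N' C'"
  shows "N = N'" and "C = C'"
proof -
  define q where "q = dim_row A"
  obtain l where N: "N \<in> seq_mats q (seq.span delta_seqs)"
    and C: "\<And>i. C i \<in> seq_mats q (seq.span geom_seqs)" 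
    and Cl: "\<And>i k. i > l \<Longrightarrow> C i k = 0\<^sub>m q q"
    and A: "\<And>k. A ^\<^sub>m k = N k + mat q q (\<lambda>(r, c). \<Sum>i\<le>l. C i k $$ (r, c) * binom_seq i k)"
    using assms(1) unfolding canonical_form_def Let_def q_def by blast
  obtain l' where N': "N' \<in> seq_mats q (seq.span delta_seqs)"
    and C': "\<And>i. C' i \<in> seq_mats q (seq.span geom_seqs)" 
    and Cl': "\<And>i k. i > l' \<Longrightarrow> C' i k = 0\<^sub>m q q"
    and A': "\<And>k. A ^\<^sub>m k = N' k + mat q q (\<lambda>(r, c). \<Sum>i\<le>l'. C' i k $$ (r, c) * binom_seq i k)"
    using assms(2) unfolding canonical_form_def Let_def q_def by blast
  have entries: "N k $$ (r, c) = N' k $$ (r, c)" "C i k $$ (r, c) = C' i k $$ (r, c)"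
    if rc: "r < q" "c < q" for r c i k
  proof -
    define m where "m = max (max l l') i"
    let ?d = "\<lambda>k. N k $$ (r, c) - N' k $$ (r, c)"
    let ?g = "\<lambda>i k. C i k $$ (r, c) - C' i k $$ (r, c)"
    have d: "?d \<in> seq.span delta_seqs"
      using seq.span_diff[of "\<lambda>k. N k $$ (r, c)" delta_seqs "\<lambda>k. N' k $$ (r, c)"] N N' rc
      by (simp add: seq_mats_def fun_diff_def)
    have g: "?g i \<in> seq.span geom_seqs" for i
      using seq.span_diff[of "\<lambda>k. C i k $$ (r, c)" geom_seqs "\<lambda>k. C' i k $$ (r, c)"] C[of i] C'[of i] rc
      by (simp add: seq_mats_def fun_diff_def)
    have z: "?d k + (\<Sum>i\<le>m. ?g i k * binom_seq i k) = 0" for k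
    proof -
      have "(\<Sum>i\<le>l. C i k $$ (r, c) * binom_seq i k) = (\<Sum>i\<le>m. C i k $$ (r, c) * binom_seq i k)"
        by (rule sum.mono_neutral_left) (use rc in \<open>auto simp: m_def Cl\<close>)
      moreover have "(\<Sum>i\<le>l'. C' i k $$ (r, c) * binom_seq i k) = (\<Sum>i\<le>m. C' i k $$ (r, c) * binom_seq i k)"
        by (rule sum.mono_neutral_left) (use rc in \<open>auto simp: m_def Cl'\<close>)
      moreover have "(A ^\<^sub>m k) $$ (r, c) = N k $$ (r, c) + (\<Sum>i\<le>l. C i k $$ (r, c) * binom_seq i k)"
        unfolding A using rc by simp
      moreover have "(A ^\<^sub>m k) $$ (r, c) = N' k $$ (r, c) + (\<Sum>i\<le>l'. C' i k $$ (r, c) * binom_seq i k)"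
        unfolding A' using rc by simp
      ultimately show ?thesis
        by (simp add: sum_subtractf left_diff_distrib algebra_simps)
    qed
    note indep = delta_geom_binomial_independent[OF d g z]
    show "N k $$ (r, c) = N' k $$ (r, c)" using indep(1)[of k] by simp
    show "C i k $$ (r, c) = C' i k $$ (r, c)" using indep(2)[of i k] by (simp add: m_def)
  qed
  have "N k = N' k" for k
    by (rule eq_matI) (use entries N N' in \<open>auto simp: seq_mats_def dest!: spec[of _ k]\<close>)
  thus "N = N'" ..
  have "C i k = C' i k" for i k
    by (rule eq_matI) (use entries C[of i] C'[of i] in \<open>auto simp: seq_mats_def dest!: spec[of _ k]\<close>)
  thus "C = C'" by (simp add: fun_eq_iff)
qed

section \<open>The canonical form given by a Jordan--Chevalley decomposition\<close>

lemma index_mult_mat_sum: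
  fixes A B :: "'a::semiring_0 mat"
  assumes "A \<in> carrier_mat n m" and "B \<in> carrier_mat m p" and "r < n" and "c < p"
  shows "(A * B) $$ (r, c) = (\<Sum>s<m. A $$ (r, s) * B $$ (s, c))"
  using assms by (simp add: scalar_prod_def atLeast0LessThan)

lemma pow_mat_commute:
  fixes S N :: "'a::semiring_1 mat"
  assumes S: "S \<in> carrier_mat q q" and N: "N \<in> carrier_mat q q" and "S * N = N * S"
  shows "N ^\<^sub>m i * S = S * N ^\<^sub>m i"
proof (induction i)
  case 0
  thus ?case using S N by simp
next
  case (Suc i)
  have Ni: "N ^\<^sub>m i \<in> carrier_mat q q" using N by simp
  have "N ^\<^sub>m Suc i * S = N ^\<^sub>m i * (N * S)"
    unfolding pow_mat.simps by (rule assoc_mult_mat[OF Ni N S])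
  also have "\<dots> = S * N ^\<^sub>m i * N"
    unfolding assms(3)[symmetric] Suc.IH[symmetric] by (rule assoc_mult_mat[OF Ni S N, symmetric])
  also have "\<dots> = S * N ^\<^sub>m Suc i"
    unfolding pow_mat.simps by (rule assoc_mult_mat[OF S Ni N])
  finally show ?case .
qed

text \<open>
  The binomial theorem for commuting square matrices, stated entrywise because matrices of
  unspecified dimension have no \<open>sum\<close>.
\<close>

lemma pow_mat_add_commuting:
  fixes S N :: "'a::comm_ring_1 mat"
  assumes S: "S \<in> carrier_mat q q" and N: "N \<in> carrier_mat q q" and comm: "S * N = N * S"
    and rc: "r < q" "c < q"
  shows "((S + N) ^\<^sub>m k) $$ (r, c) = (\<Sum>i\<le>k. (S ^\<^sub>m (k - i) * N ^\<^sub>m i) $$ (r, c) * of_nat (k choose i))"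
  using rc
proof (induction k arbitrary: c)
  case 0
  thus ?case using S N by simp
next
  case (Suc k)
  let ?M = "\<lambda>k i. S ^\<^sub>m (k - i) * N ^\<^sub>m i"
  have M: "?M k i \<in> carrier_mat q q" for k i
    by (rule mult_carrier_mat[of _ q q]) (use S N in auto)
  have MS: "?M k i * S = ?M (Suc k) i" if "i \<le> k" for i
  proof -
    have Sk: "S ^\<^sub>m (k - i) \<in> carrier_mat q q" and Ni: "N ^\<^sub>m i \<in> carrier_mat q q"
      using S N by auto
    show ?thesis
      unfolding assoc_mult_mat[OF Sk Ni S] pow_mat_commute[OF S N comm]
        assoc_mult_mat[OF Sk S Ni, symmetric]
      using that by (simp add: Suc_diff_le)
  qed
  have MN: "?M k i * N = ?M (Suc k) (Suc i)" for i
    using assoc_mult_mat[of "S ^\<^sub>m (k - i)" q q "N ^\<^sub>m i" q N q] S N by simp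
  have "((S + N) ^\<^sub>m Suc k) $$ (r, c) = (\<Sum>s<q. ((S + N) ^\<^sub>m k) $$ (r, s) * (S + N) $$ (s, c))"
    using S N Suc.prems by (simp add: scalar_prod_def atLeast0LessThan)
  also have "\<dots> = (\<Sum>s<q. \<Sum>i\<le>k. (?M k i) $$ (r, s) * (S $$ (s, c) + N $$ (s, c)) * of_nat (k choose i))"
    using S N Suc by (intro sum.cong) (simp_all add: sum_distrib_right sum_distrib_left mult_ac)
  also have "\<dots> = (\<Sum>i\<le>k. \<Sum>s<q. (?M k i) $$ (r, s) * (S $$ (s, c) + N $$ (s, c)) * of_nat (k choose i))"
    by (rule sum.swap)
  also have "\<dots> = (\<Sum>i\<le>k. ((?M k i * S) $$ (r, c) + (?M k i * N) $$ (r, c)) * of_nat (k choose i))"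
  proof (rule sum.cong)
    fix i
    have "(?M k i * X) $$ (r, c) = (\<Sum>s<q. (?M k i) $$ (r, s) * X $$ (s, c))" 
      if "X \<in> carrier_mat q q" for X
      by (rule index_mult_mat_sum[OF M that rc(1) Suc.prems(2)])
    thus "(\<Sum>s<q. (?M k i) $$ (r, s) * (S $$ (s, c) + N $$ (s, c)) * of_nat (k choose i)) =
       ((?M k i * S) $$ (r, c) + (?M k i * N) $$ (r, c)) * of_nat (k choose i)"
      using S N by (simp add: sum_distrib_right sum.distrib distrib_left distrib_right)
  qed simp
  also have "\<dots> = (\<Sum>i\<le>k. ((?M (Suc k) i) $$ (r, c) + (?M (Suc k) (Suc i)) $$ (r, c)) * of_nat (k choose i))"
    unfolding MN by (rule sum.cong) (simp_all only: MS atMost_iff)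
  also have "\<dots> = (\<Sum>i\<le>Suc k. (?M (Suc k) i) $$ (r, c) * of_nat (Suc k choose i))"
    unfolding sum_binomial_Suc distrib_right sum.distrib
    by (simp add: lessThan_Suc_atMost binomial_eq_0)
  finally show ?case .
qed

text \<open>
  Every Jordan--Chevalley decomposition can be read off from a canonical form.
\<close>

lemma canonical_form_if_jordan_chevalley:
  fixes A :: "'a::field mat"
  assumes jc: "jordan_chevalley A S N"
  shows "\<exists>U C. canonical_form A U C \<and> C 0 1 = S \<and> U 1 + C 1 1 = N"
proof -
  define q where "q = dim_row A"
  have S: "S \<in> carrier_mat q q" and N: "N \<in> carrier_mat q q" and A: "A = S + N"
    and comm: "S * N = N * S" and diag: "diagonalizable_mat S" and nilp: "nilpotent_mat N"
    using jc unfolding jordan_chevalley_def q_def[symmetric] by blast+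
  obtain D P Q where "diagonal_mat D" and wit: "similar_mat_wit S D P Q"
    using diag unfolding diagonalizable_mat_def similar_mat_def by blast
  note w = similar_mat_witD2[OF S wit]
  have P: "P \<in> carrier_mat q q" and Q: "Q \<in> carrier_mat q q" and PQ: "P * Q = 1\<^sub>m q"
    using w by auto
  define d where "d j = D $$ (j, j)" for j
  have D: "D = mat_diag q d"
    by (rule eq_matI) (use \<open>diagonal_mat D\<close> w in \<open>auto simp: d_def mat_diag_def diagonal_mat_def\<close>)
  \<comment> \<open>The matrix with the eigenvectors of \<open>S\<close> and eigenvalues \<open>e j\<close> in place of \<open>d j\<close>.\<close>
  define E where "E e = P * mat_diag q e * Q" for e
  have E: "E e \<in> carrier_mat q q" for e
    unfolding E_def using P Q by auto
  have Sk: "S ^\<^sub>m k = E (\<lambda>j. d j ^ k)" for k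
  proof -
    have "mat_diag q d ^\<^sub>m k = mat_diag q (\<lambda>j. d j ^ k)"
    proof (induction k)
      case 0
      have "dim_row (mat_diag q d) = q" by (simp add: mat_diag_def)
      thus ?case by simp
    qed (simp add: mult.commute)
    thus ?thesis
      using similar_mat_wit_pow_id[OF wit, of k] by (simp add: D E_def)
  qed
  have entry: "(E e * N ^\<^sub>m i) $$ (r, c) = (\<Sum>j<q. P $$ (r, j) * (Q * N ^\<^sub>m i) $$ (j, c) * e j)"
    if rc: "r < q" "c < q" for e i r c
  proof -
    have Ni: "N ^\<^sub>m i \<in> carrier_mat q q" and QN: "Q * N ^\<^sub>m i \<in> carrier_mat q q"
      using N Q by auto
    have "E e * N ^\<^sub>m i = P * mat_diag q e * (Q * N ^\<^sub>m i)"
      unfolding E_def by (rule assoc_mult_mat[OF mult_carrier_mat[OF P mat_diag_dim] Q Ni])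
    also have "\<dots> = P * (mat_diag q e * (Q * N ^\<^sub>m i))"
      by (rule assoc_mult_mat[OF P mat_diag_dim QN])
    also have "\<dots> = P * mat q q (\<lambda>(j, c). e j * (Q * N ^\<^sub>m i) $$ (j, c))"
      unfolding mat_diag_mult_left[OF QN] ..
    also have "\<dots> $$ (r, c) =
        (\<Sum>j<q. P $$ (r, j) * mat q q (\<lambda>(j, c). e j * (Q * N ^\<^sub>m i) $$ (j, c)) $$ (j, c))"
      by (rule index_mult_mat_sum[OF P mat_carrier rc])
    also have "\<dots> = (\<Sum>j<q. P $$ (r, j) * (Q * N ^\<^sub>m i) $$ (j, c) * e j)"
      using rc by (intro sum.cong) (auto simp: mult_ac)
    finally show ?thesis .
  qed
  define U where "U k = E (\<lambda>j. if d j = 0 then 1 else 0) * N ^\<^sub>m k" for k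
  define C where "C i k = E (\<lambda>j. if d j = 0 then 0 else d j ^ k * inverse (d j) ^ i) * N ^\<^sub>m i" for i k
  have Uc: "U k \<in> carrier_mat q q" and Cc: "C i k \<in> carrier_mat q q" for i k
    unfolding U_def C_def by (rule mult_carrier_mat[OF E pow_carrier_mat[OF N]])+
  obtain l where l: "N ^\<^sub>m l = 0\<^sub>m q q"
    using nilp N unfolding nilpotent_mat_def by auto
  have Nl: "N ^\<^sub>m i = 0\<^sub>m q q" if "l \<le> i" for i
    using that
  proof (induction rule: dec_induct)
    case (step i)
    thus ?case using N by simp
  qed (rule l)
  have E0: "E e * 0\<^sub>m q q = 0\<^sub>m q q" for e
    by (rule right_mult_zero_mat[OF E])
  have "U \<in> seq_mats q (seq.span delta_seqs)"
    using Uc by (auto simp: seq_mats_def span_delta_seqs_iff U_def Nl E0 intro!: exI[of _ l])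
  moreover have "C i \<in> seq_mats q (seq.span geom_seqs)" for i
  proof -
    have "(\<lambda>k. C i k $$ (r, c)) \<in> seq.span geom_seqs" if rc: "r < q" "c < q" for r c
    proof -
      have Cs: "C i k $$ (r, c) =
          (\<Sum>j\<in>{j. j < q \<and> d j \<noteq> 0}. P $$ (r, j) * (Q * N ^\<^sub>m i) $$ (j, c) * inverse (d j) ^ i * d j ^ k)" for k
        unfolding C_def entry[OF rc]
        by (rule sum.mono_neutral_cong_right) (auto simp: mult_ac)
      show ?thesis
        unfolding Cs by (rule span_geom_seqsI) auto
    qed
    thus ?thesis using Cc by (simp add: seq_mats_def)
  qed
  moreover have "C i k = 0\<^sub>m q q" if "i > l" for i k
    using that by (simp add: C_def Nl E0)
  moreover have "A ^\<^sub>m k = U k + mat q q (\<lambda>(r, c). \<Sum>i\<le>l. C i k $$ (r, c) * binom_seq i k)" for k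
  proof (rule eq_matI)
    fix r c assume "r < dim_row (U k + mat q q (\<lambda>(r, c). \<Sum>i\<le>l. C i k $$ (r, c) * binom_seq i k))"
      "c < dim_col (U k + mat q q (\<lambda>(r, c). \<Sum>i\<le>l. C i k $$ (r, c) * binom_seq i k))"
    hence rc: "r < q" "c < q" by auto
    let ?m = "max k l"
    \<comment> \<open>Since \<open>0\<^sup>0 = 1\<close>, the eigenvalue \<open>0\<close> contributes exactly at \<open>i = k\<close>.\<close>
    have "(S ^\<^sub>m (k - i) * N ^\<^sub>m i) $$ (r, c) = C i k $$ (r, c) + (if i = k then U k $$ (r, c) else 0)"
      if "i \<le> k" for i
    proof -
      have pow: "d j ^ (k - i) = (if d j = 0 then 0 else d j ^ k * inverse (d j) ^ i) +
          (if i = k then if d j = 0 then 1 else 0 else 0)" for j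
      proof (cases "d j = 0")
        case True
        thus ?thesis using that by (simp add: power_0_left)
      next
        case False
        thus ?thesis using that by (simp add: power_diff divide_inverse power_inverse)
      qed
      show ?thesis
        unfolding Sk C_def U_def entry[OF rc] pow
        by (cases "i = k") (simp_all only: distrib_left sum.distrib simp_thms if_True if_False
            mult_zero_right sum.neutral_const)
    qed
    hence "(A ^\<^sub>m k) $$ (r, c) =
        (\<Sum>i\<le>k. (C i k $$ (r, c) + (if i = k then U k $$ (r, c) else 0)) * of_nat (k choose i))"
      unfolding A pow_mat_add_commuting[OF S N comm rc] by simp
    also have "\<dots> = (\<Sum>i\<le>k. C i k $$ (r, c) * of_nat (k choose i)) + (\<Sum>i\<le>k. if i = k then U k $$ (r, c) else 0)"
      unfolding sum.distrib[symmetric] by (rule sum.cong) (auto simp: distrib_right)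
    also have "(\<Sum>i\<le>k. C i k $$ (r, c) * of_nat (k choose i)) = (\<Sum>i\<le>?m. C i k $$ (r, c) * of_nat (k choose i))"
      by (rule sum.mono_neutral_left) (auto simp: binomial_eq_0)
    also have "\<dots> = (\<Sum>i\<le>l. C i k $$ (r, c) * binom_seq i k)"
      unfolding binom_seq_def
      by (rule sum.mono_neutral_right) (use \<open>\<And>i k. i > l \<Longrightarrow> C i k = 0\<^sub>m q q\<close> rc in auto)
    finally show "(A ^\<^sub>m k) $$ (r, c) = (U k + mat q q (\<lambda>(r, c). \<Sum>i\<le>l. C i k $$ (r, c) * binom_seq i k)) $$ (r, c)"
      using rc Uc[of k] by (simp add: add.commute)
  qed (use S N Uc A in auto)
  ultimately have "canonical_form A U C"
    unfolding canonical_form_def Let_def q_def[symmetric] by blast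
  moreover have "C 0 1 = S"
  proof -
    have "(\<lambda>j. if d j = 0 then 0 else d j ^ 1 * inverse (d j) ^ 0) = (\<lambda>j. d j ^ 1)"
      by auto
    hence "C 0 1 = S ^\<^sub>m 1 * 1\<^sub>m q"
      unfolding C_def Sk using N by simp
    thus ?thesis using S by simp
  qed
  moreover have "U 1 + C 1 1 = N"
  proof -
    have "U 1 + C 1 1 = E (\<lambda>_. 1) * N ^\<^sub>m 1"
    proof (rule eq_matI)
      fix r c assume "r < dim_row (E (\<lambda>_. 1) * N ^\<^sub>m 1)" "c < dim_col (E (\<lambda>_. 1) * N ^\<^sub>m 1)"
      hence rc: "r < q" "c < q" using E[of "\<lambda>_. 1"] N by auto
      have "(U 1 + C 1 1) $$ (r, c) = U 1 $$ (r, c) + C 1 1 $$ (r, c)"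
        using rc Uc[of 1] Cc[of 1 1] by simp
      also have "\<dots> = (E (\<lambda>_. 1) * N ^\<^sub>m 1) $$ (r, c)"
        unfolding U_def C_def entry[OF rc] sum.distrib[symmetric]
        by (rule sum.cong) auto
      finally show "(U 1 + C 1 1) $$ (r, c) = (E (\<lambda>_. 1) * N ^\<^sub>m 1) $$ (r, c)" .
    qed (use Uc[of 1] Cc[of 1 1] E[of "\<lambda>_. 1"] N in auto)
    also have "E (\<lambda>_. 1) = 1\<^sub>m q"
      unfolding E_def using P PQ by simp
    finally show ?thesis using N by simp
  qed
  ultimately show ?thesis by blast
qed

section \<open>The diagonalizable and nilpotent parts in terms of the canonical form\<close>

theorem corollary3p8:
  fixes A :: "'a::field mat" and q :: nat
  assumes "A \<in> carrier_mat q q"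
    and "\<exists>as. char_poly A = (\<Prod>a\<leftarrow>as. [:- a, 1:])"
  shows "diag_part A = coord A 0 1 \<and>
    nilp_part A = A - diag_part A \<and>
    A - diag_part A = nongeom_part A 1 + coord A 1 1"
proof -
  obtain S N where jc: "jordan_chevalley A S N"
    using jordan_chevalley_exists assms by blast
  obtain U C where cf: "canonical_form A U C" and S: "C 0 1 = S" and N: "U 1 + C 1 1 = N"
    using canonical_form_if_jordan_chevalley[OF jc] by blast
  have U: "nongeom_part A = U"
    unfolding nongeom_part_def
    by (rule the_equality) (use cf canonical_form_unique(1)[OF _ cf] in blast)+
  have C: "coord A = C"
    unfolding coord_def
    by (rule the_equality) (use cf canonical_form_unique(2)[OF _ cf] in blast)+
  have unique: "S' = S \<and> N' = N" if jc': "jordan_chevalley A S' N'" for S' N'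
  proof -
    obtain U' C' where cf': "canonical_form A U' C'" and "C' 0 1 = S'" "U' 1 + C' 1 1 = N'"
      using canonical_form_if_jordan_chevalley[OF jc'] by blast
    thus ?thesis
      using canonical_form_unique[OF cf' cf] S N by simp
  qed
  have diag: "diag_part A = S"
    unfolding diag_part_def by (rule the_equality) (use jc unique in blast)+
  have nilp: "nilp_part A = N"
    unfolding nilp_part_def by (rule the_equality) (use jc unique in blast)+
  have A: "A = S + N" and "S \<in> carrier_mat (dim_row A) (dim_row A)"
      "N \<in> carrier_mat (dim_row A) (dim_row A)"
    using jc unfolding jordan_chevalley_def by blast+
  hence c: "S \<in> carrier_mat q q" "N \<in> carrier_mat q q"
    using assms(1) by (metis carrier_matD(1))+
  have "A - S = N"
    unfolding A by (rule eq_matI) (use c in auto)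
  thus ?thesis
    unfolding U C diag nilp S N by simp
qed

end
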